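(* Let $$ a := \max\left\{ \frac{(1+t)^2 (1-t)\, t}{4(1+4t+4t^2)} : t \in [0,1] \right\} \approx 3.63000825 \times 10^{-2}. $$ The error of best approximation on the euclidean ball $B \subseteq \mathbb{R}^3$ to the monomial $m_{(2,2,1)}(x_1,x_2,x_3) = x_1^2 x_2^2 x_3$ by trivariate polynomials of degree at most $4$ is $$ E_{\mathcal{P}_4^3}(m_{(2,2,1)}, B) = a, $$ while a Chebyshev polynomial (for $m_{(2,2,1)}$ relative to $B$) is given by $$ P(x) = m_{(2,2,1)}(x_1,x_2,x_3) + a\, T_3(x_3), $$ where $T_3(t) = 4t^3 - 3t$ is the univariate Chebyshev polynomial of degree $3$.
   Context: $B = \{ x \in \mathbb{R}^3 : x_1^2 + x_2^2 + x_3^2 \le 1 \}$. $\mathcal{P}_4^3$ is the space of real polynomials in three variables of total degree at most $4$. $\|g\|_B = \max_{x \in B} |g(x)|$ and $E_{\mathcal{P}_4^3}(f,B) = \min_{p \in \mathcal{P}_4^3} \|f - p\|_B$. A Chebyshev polynomial for a monomial $m_k$ of degree $n$ relative to a domain $\Omega$ is a polynomial of the form $m_k - p^*$, where $p^*$ is a best approximant to $m_k$ from the polynomials of total degree at most $n-1$, i.e., a minimizer of $\|m_k - p\|_\Omega$; here this means that $P - m_{(2,2,1)} \in \mathcal{P}_4^3$ and $\|P\|_B = E_{\mathcal{P}_4^3}(m_{(2,2,1)},B)$. Chebyshev polynomials need not be unique. *)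

theory Defs
  imports "HOL-Analysis.Analysis"
begin

text \<open>Multi-indices are vectors of type \<open>nat ^ 'd\<close>; polynomials in \<open>CARD('d)\<close> real variables are
  represented by the functions they induce on \<open>real ^ 'd\<close>.\<close>

definition total_degree :: "nat ^ 'd::finite \<Rightarrow> nat" where
  "total_degree k = (\<Sum>i\<in>UNIV. k $ i)"

definition mono_fun :: "nat ^ 'd::finite \<Rightarrow> real ^ 'd \<Rightarrow> real" where
  "mono_fun k x = (\<Prod>i\<in>UNIV. (x $ i) ^ (k $ i))"

definition poly_funs :: "nat \<Rightarrow> (real ^ 'd::finite \<Rightarrow> real) set" where
  "poly_funs n =
     {p. \<exists>c. p = (\<lambda>x. \<Sum>k | total_degree k \<le> n. c k * mono_fun k x)}"

text \<open>The maximum and the minimum below are literal: \<open>GREATEST\<close> and \<open>LEAST\<close> are unspecified where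
  the extremum is not attained, unlike \<open>Sup\<close> and \<open>Inf\<close>.\<close>

definition max_norm :: "'a set \<Rightarrow> ('a \<Rightarrow> real) \<Rightarrow> real" where
  "max_norm \<Omega> g = (GREATEST r. \<exists>x\<in>\<Omega>. r = \<bar>g x\<bar>)"

definition approx_error :: "('a \<Rightarrow> real) set \<Rightarrow> ('a \<Rightarrow> real) \<Rightarrow> 'a set \<Rightarrow> real" where
  "approx_error V f \<Omega> = (LEAST r. \<exists>p\<in>V. r = max_norm \<Omega> (\<lambda>x. f x - p x))"

definition best_approximant ::
    "('a \<Rightarrow> real) set \<Rightarrow> ('a \<Rightarrow> real) \<Rightarrow> 'a set \<Rightarrow> ('a \<Rightarrow> real) \<Rightarrow> bool" where
  "best_approximant V f \<Omega> p \<longleftrightarrow>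
     p \<in> V \<and> (\<forall>q\<in>V. max_norm \<Omega> (\<lambda>x. f x - p x) \<le> max_norm \<Omega> (\<lambda>x. f x - q x))"

text \<open>Meaningful for \<open>total_degree k \<ge> 1\<close> only, because of truncated subtraction.\<close>

definition chebyshev_poly ::
    "nat ^ 'd::finite \<Rightarrow> (real ^ 'd) set \<Rightarrow> (real ^ 'd \<Rightarrow> real) \<Rightarrow> bool" where
  "chebyshev_poly k \<Omega> P \<longleftrightarrow>
     (\<exists>p. best_approximant (poly_funs (total_degree k - 1)) (mono_fun k) \<Omega> p \<and>
          P = (\<lambda>x. mono_fun k x - p x))"

definition T3 :: "real \<Rightarrow> real" where
  "T3 t = 4 * t ^ 3 - 3 * t"

abbreviation k221 :: "nat ^ 3" where
  "k221 \<equiv> vector [2, 2, 1]"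

lemma total_degree_k221: "total_degree k221 = 5"
  by (simp add: total_degree_def sum_3)

lemma mono_fun_k221: "mono_fun k221 x = (x $ 1)\<^sup>2 * (x $ 2)\<^sup>2 * x $ 3"
proof -
  have "mono_fun k221 x = x $ 1 ^ (k221 $ 1) * (x $ 2 ^ (k221 $ 2) * x $ 3 ^ (k221 $ 3))"
    unfolding mono_fun_def UNIV_3 by simp
  also have "\<dots> = (x $ 1)\<^sup>2 * (x $ 2)\<^sup>2 * x $ 3"
    unfolding vector_3 by simp
  finally show ?thesis .
qed

lemma finite_total_degree_le: "finite {k :: nat ^ 'd::finite. total_degree k \<le> n}"
proof (rule finite_subset)
  show "{k :: nat ^ 'd. total_degree k \<le> n} \<subseteq> vec_lambda ` (UNIV \<rightarrow>\<^sub>E {..n})"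
  proof
    fix k :: "nat ^ 'd"
    assume "k \<in> {k. total_degree k \<le> n}"
    then have "k $ i \<le> n" for i
      using member_le_sum[of i UNIV "($) k"] by (simp add: total_degree_def)
    then have "($) k \<in> UNIV \<rightarrow>\<^sub>E {..n}" by auto
    moreover have "k = vec_lambda (($) k)" by simp
    ultimately show "k \<in> vec_lambda ` (UNIV \<rightarrow>\<^sub>E {..n})" by blast
  qed
  show "finite (vec_lambda ` ((UNIV :: 'd set) \<rightarrow>\<^sub>E {..n}))"
    by (intro finite_imageI finite_PiE) auto
qed

lemma best_approximant_error:
  assumes "best_approximant V f \<Omega> p"
  shows "max_norm \<Omega> (\<lambda>x. f x - p x) = approx_error V f \<Omega>"
  using assms unfolding best_approximant_def approx_error_def
  by (intro Least_equality[symmetric]) auto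

end

theory Submission
  imports Defs
begin

text \<open>Write \<open>m\<close> for the monomial \<open>x\<^sub>1\<^sup>2 x\<^sub>2\<^sup>2 x\<^sub>3\<close>, \<open>P = m + a T\<^sub>3(x\<^sub>3)\<close>, and let \<open>\<tau>\<close> be a point
  where the quotient defining \<open>a\<close> is maximal.

  At fixed height \<open>x\<^sub>3 = z \<ge> 0\<close> the monomial ranges over the interval from \<open>0\<close> to
  \<open>(1 - z\<^sup>2)\<^sup>2 z / 4\<close>, so \<open>P\<close> lies between \<open>a T\<^sub>3(z) \<ge> -a\<close> and \<open>(1 - z\<^sup>2)\<^sup>2 z / 4 + a T\<^sub>3(z)\<close>.  Because
  \<open>1 - T\<^sub>3(z) = (1 - z)(1 + 2z)\<^sup>2\<close>, the latter is at most \<open>a\<close> precisely when \<open>a\<close> dominates the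
  quotient at \<open>z\<close>.  Hence \<open>\<bar>P\<bar> \<le> a\<close> on the ball (lemma \<open>deviation_le\<close>), and this is where the definition
  of \<open>a\<close> comes from.

  Optimality is shown by duality: it suffices to find a linear functional that vanishes on all
  polynomials of degree at most 4 and is a combination of point evaluations at points where \<open>P\<close>
  equals \<open>\<plusminus>a\<close>, with weights of the sign of \<open>P\<close>.  The points available are the poles
  \<open>(0, 0, \<plusminus>1)\<close>, the points \<open>(\<plusminus>s, \<plusminus>s, \<plusminus>\<tau>)\<close> with \<open>s\<^sup>2 = (1 - \<tau>\<^sup>2) / 2\<close>, and the points at height
  \<open>\<plusminus>1/2\<close> in the planes \<open>x\<^sub>1 = 0\<close> and \<open>x\<^sub>2 = 0\<close>, because \<open>T\<^sub>3(1/2) = -1\<close>.  Antisymmetrising in \<open>x\<^sub>3\<close>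
  and symmetrising in \<open>x\<^sub>1\<close> and \<open>x\<^sub>2\<close> leaves only the conditions for \<open>x\<^sub>3\<close>, \<open>x\<^sub>3\<^sup>3\<close>, \<open>x\<^sub>1\<^sup>2 x\<^sub>3\<close> and
  \<open>x\<^sub>2\<^sup>2 x\<^sub>3\<close>.  They determine the weights up to scaling, and they force the points at height
  \<open>\<plusminus>1/2\<close> onto the unit sphere.  The weight at the poles comes out as \<open>\<tau> (1 - 4 \<tau>\<^sup>2)\<close>, which has the
  right sign because \<open>\<tau> \<le> 1/2\<close>.  The resulting lower bound is \<open>error_quotient_le_deviation\<close>.  It holds with
  every \<open>t \<in> [0, 1/2]\<close> in place of \<open>\<tau>\<close>, and \<open>\<tau>\<close> is where it is strongest.\<close>

section \<open>Attained maxima\<close>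

lemma Greatest_attained:
  fixes g :: "'a::topological_space \<Rightarrow> real"
  assumes "compact S" "S \<noteq> {}" "continuous_on S g"
  obtains x where "x \<in> S" "(GREATEST r. \<exists>x\<in>S. r = g x) = g x" "\<And>y. y \<in> S \<Longrightarrow> g y \<le> g x"
proof -
  obtain x where x: "x \<in> S" "\<forall>y\<in>S. g y \<le> g x"
    using continuous_attains_sup[OF assms] by blast
  have "(GREATEST r. \<exists>x\<in>S. r = g x) = g x"
    using x by (intro Greatest_equality) auto
  with x that show thesis by blast
qed

lemma abs_le_max_norm:
  fixes g :: "'a::topological_space \<Rightarrow> real"
  assumes "compact \<Omega>" "continuous_on \<Omega> g" "x \<in> \<Omega>"
  shows "\<bar>g x\<bar> \<le> max_norm \<Omega> g"
proof -
  have "continuous_on \<Omega> (\<lambda>x. \<bar>g x\<bar>)" using assms(2) by (intro continuous_intros)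
  then show ?thesis
    using Greatest_attained[of \<Omega> "\<lambda>x. \<bar>g x\<bar>"] assms unfolding max_norm_def by (metis empty_iff)
qed

section \<open>Polynomial functions\<close>

lemma continuous_on_mono_fun: "continuous_on S (mono_fun k)"
  unfolding mono_fun_def by (intro continuous_intros)

lemma continuous_on_poly_funs: "p \<in> poly_funs n \<Longrightarrow> continuous_on S p"
  unfolding poly_funs_def by (auto intro!: continuous_intros continuous_on_mono_fun)

lemma mono_fun_in_poly_funs:
  assumes "total_degree k \<le> n"
  shows "mono_fun k \<in> poly_funs n"
proof -
  have "mono_fun k = (\<lambda>x. \<Sum>l | total_degree l \<le> n. (if l = k then 1 else 0) * mono_fun l x)"
    using assms by (simp add: if_distrib[of "\<lambda>c. c * _"] finite_total_degree_le cong: if_cong)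
  then show ?thesis
    unfolding poly_funs_def mem_Collect_eq by (rule exI[where x = "\<lambda>l. if l = k then 1 else 0"])
qed

lemma poly_funs_scale:
  assumes "p \<in> poly_funs n"
  shows "(\<lambda>x. r * p x) \<in> poly_funs n"
proof -
  from assms obtain c where "p = (\<lambda>x. \<Sum>k | total_degree k \<le> n. c k * mono_fun k x)"
    unfolding poly_funs_def by blast
  then have "(\<lambda>x. r * p x) = (\<lambda>x. \<Sum>k | total_degree k \<le> n. (r * c k) * mono_fun k x)"
    by (simp add: sum_distrib_left mult.assoc)
  then show ?thesis
    unfolding poly_funs_def mem_Collect_eq by (rule exI[where x = "\<lambda>k. r * c k"])
qed

lemma poly_funs_add:
  assumes "p \<in> poly_funs n" "q \<in> poly_funs n"
  shows "(\<lambda>x. p x + q x) \<in> poly_funs n"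
proof -
  from assms obtain c d where "p = (\<lambda>x. \<Sum>k | total_degree k \<le> n. c k * mono_fun k x)"
    and "q = (\<lambda>x. \<Sum>k | total_degree k \<le> n. d k * mono_fun k x)"
    unfolding poly_funs_def by blast
  then have "(\<lambda>x. p x + q x) = (\<lambda>x. \<Sum>k | total_degree k \<le> n. (c k + d k) * mono_fun k x)"
    by (simp add: sum.distrib distrib_right)
  then show ?thesis
    unfolding poly_funs_def mem_Collect_eq by (rule exI[where x = "\<lambda>k. c k + d k"])
qed

lemma mono_fun_3: "mono_fun k (x :: real ^ 3) = x $ 1 ^ k $ 1 * x $ 2 ^ k $ 2 * x $ 3 ^ k $ 3"
  unfolding mono_fun_def UNIV_3 by (simp add: mult.assoc)

lemma T3_in_poly_funs: "(\<lambda>x :: real ^ 3. r * T3 (x $ 3)) \<in> poly_funs 4"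
proof -
  have deg: "total_degree (vector [0, 0, 3] :: nat ^ 3) \<le> 4"
    "total_degree (vector [0, 0, 1] :: nat ^ 3) \<le> 4"
    by (simp_all add: total_degree_def sum_3)
  have "(\<lambda>x :: real ^ 3. (4 * r) * mono_fun (vector [0, 0, 3]) x
      + (- 3 * r) * mono_fun (vector [0, 0, 1]) x) \<in> poly_funs 4"
    by (intro poly_funs_add poly_funs_scale mono_fun_in_poly_funs deg)
  then show ?thesis by (simp add: mono_fun_3 T3_def algebra_simps)
qed

section \<open>The quotient defining the error\<close>

definition error_quotient :: "real \<Rightarrow> real" where
  "error_quotient t = ((1 + t)\<^sup>2 * (1 - t) * t) / (4 * (1 + 4 * t + 4 * t\<^sup>2))"

lemma denominator_pos: "0 \<le> t \<Longrightarrow> 0 < 4 * (1 + 4 * t + 4 * t\<^sup>2)" for t :: real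
  by (simp add: add_nonneg_pos add_pos_nonneg)

lemma continuous_on_error_quotient: "continuous_on {0..1} error_quotient"
proof -
  have "\<forall>t\<in>{0..1}. 4 * (1 + 4 * t + 4 * t\<^sup>2) \<noteq> (0::real)"
    using denominator_pos by (metis atLeastAtMost_iff less_irrefl)
  then show ?thesis
    unfolding error_quotient_def by (intro continuous_intros) auto
qed

text \<open>The quartic \<open>4 c (1 + 2t)\<^sup>2 - (1 + t)\<^sup>2 (1 - t) t\<close> has a double root at the maximising point when
  \<open>c\<close> is the maximum.  For \<open>c\<close> slightly larger, division by \<open>(t - \<theta>)\<^sup>2\<close> with a rational \<open>\<theta>\<close> close
  to that point leaves a linear remainder with nonnegative coefficients.\<close>

lemma error_quotient_le:
  assumes "0 \<le> t"
  shows "error_quotient t \<le> 3630008259 / 10 ^ 11"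
proof -
  define \<theta> :: real where "\<theta> = 405267856883 / 10 ^ 12"
  define c :: real where "c = 3630008259 / 10 ^ 11"
  define d where "d = 16 * c - 1 + 2 * \<theta> + 3 * \<theta>\<^sup>2"
  have division: "4 * c * (1 + 4 * t + 4 * t\<^sup>2) - (1 + t)\<^sup>2 * (1 - t) * t
      = (t - \<theta>)\<^sup>2 * (t\<^sup>2 + (1 + 2 * \<theta>) * t + d)
        + (16 * c - 1 + 2 * \<theta> * d - \<theta>\<^sup>2 * (1 + 2 * \<theta>)) * t + (4 * c - \<theta>\<^sup>2 * d)"
    unfolding d_def by algebra
  have coefficients: "0 \<le> \<theta>" "0 \<le> d" "0 \<le> 16 * c - 1 + 2 * \<theta> * d - \<theta>\<^sup>2 * (1 + 2 * \<theta>)"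
    "0 \<le> 4 * c - \<theta>\<^sup>2 * d"
    by (simp_all add: d_def \<theta>_def c_def power2_eq_square)
  have "0 \<le> (t - \<theta>)\<^sup>2 * (t\<^sup>2 + (1 + 2 * \<theta>) * t + d)"
    using assms coefficients by (intro mult_nonneg_nonneg add_nonneg_nonneg) auto
  moreover have "0 \<le> (16 * c - 1 + 2 * \<theta> * d - \<theta>\<^sup>2 * (1 + 2 * \<theta>)) * t"
    using assms coefficients by (intro mult_nonneg_nonneg)
  moreover note coefficients(4)
  ultimately have "(1 + t)\<^sup>2 * (1 - t) * t \<le> 4 * c * (1 + 4 * t + 4 * t\<^sup>2)"
    using division by linarith
  then show ?thesis
    using denominator_pos[OF assms] unfolding error_quotient_def c_def
    by (simp add: pos_divide_le_eq algebra_simps)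
qed

text \<open>The argument approximates the maximising point; the value decides the numerical claim from below
  and exceeds everything in the right half of the interval.\<close>

lemma error_quotient_large_value: "3630008245 / 10 ^ 11 < error_quotient (40527 / 10 ^ 5)"
  by (simp add: error_quotient_def field_simps power2_eq_square)

text \<open>The bound is the value at \<open>1/2\<close>.  It lies below the maximum, so the maximising point is in
  the left half, which is what makes the weights of the functional below have the required signs.\<close>

lemma error_quotient_le_right_half:
  assumes "1/2 \<le> t" "t \<le> 1"
  shows "error_quotient t \<le> 9 / 256"
proof -
  \<comment> \<open>Expanded around \<open>1/2\<close>, the difference to be estimated has no negative coefficients.\<close>
  define u where "u = t - 1/2"
  have u: "0 \<le> u" "u \<le> 1/2" using assms by (auto simp: u_def)
  have "9 / 64 * (1 + 4 * t + 4 * t\<^sup>2) - (1 + t)\<^sup>2 * (1 - t) * t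
      = u ^ 4 + 3 * u ^ 3 + (41 / 16) * u\<^sup>2 + (3 / 8) * u"
    unfolding u_def by algebra
  also have "\<dots> \<ge> 0" using u by simp
  finally show ?thesis
    using denominator_pos[of t] assms unfolding error_quotient_def
    by (simp add: pos_divide_le_eq algebra_simps)
qed

section \<open>The deviation on the ball\<close>

text \<open>Both estimates rest on the points where \<open>T\<^sub>3\<close> takes the values \<open>\<plusminus>1\<close>:
  \<open>1 + T\<^sub>3(z) = (1 + z)(2z - 1)\<^sup>2\<close> gives the lower one, and \<open>1 - T\<^sub>3(z) = (1 - z)(1 + 2z)\<^sup>2\<close> turns the
  upper one into the bound on the quotient, multiplied by \<open>1 - z\<close>.\<close>

lemma deviation_le_nonneg_height:
  fixes u z a :: real
  assumes "0 \<le> u" "u \<le> ((1 - z\<^sup>2) / 2)\<^sup>2" "0 \<le> z" "z \<le> 1" "0 \<le> a" "error_quotient z \<le> a"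
  shows "\<bar>u * z + a * T3 z\<bar> \<le> a"
proof -
  have "0 \<le> a * ((1 + z) * (2 * z - 1)\<^sup>2)" using assms by simp
  also have "\<dots> = a + a * T3 z" unfolding T3_def by algebra
  finally have lower: "- a \<le> u * z + a * T3 z"
    using mult_nonneg_nonneg[OF assms(1,3)] by linarith
  have "(1 + z)\<^sup>2 * (1 - z) * z \<le> a * (4 * (1 + 4 * z + 4 * z\<^sup>2))"
    using assms(6) denominator_pos[OF assms(3)]
    unfolding error_quotient_def by (simp add: pos_divide_le_eq)
  then have "(1 - z) * ((1 + z)\<^sup>2 * (1 - z) * z) \<le> (1 - z) * (a * (4 * (1 + 4 * z + 4 * z\<^sup>2)))"
    using assms(4) by (intro mult_left_mono) auto
  also have "(1 - z) * ((1 + z)\<^sup>2 * (1 - z) * z) = 4 * (((1 - z\<^sup>2) / 2)\<^sup>2 * z)"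
    by (simp add: field_simps power2_eq_square)
  also have "(1 - z) * (a * (4 * (1 + 4 * z + 4 * z\<^sup>2))) = 4 * (a - a * T3 z)"
    unfolding T3_def by algebra
  finally have "((1 - z\<^sup>2) / 2)\<^sup>2 * z \<le> a - a * T3 z" by simp
  moreover have "u * z \<le> ((1 - z\<^sup>2) / 2)\<^sup>2 * z" using assms by (intro mult_right_mono) auto
  ultimately show ?thesis using lower by linarith
qed

text \<open>The deviation is odd in the last coordinate, and by the inequality of arithmetic and geometric
  means \<open>x\<^sub>1\<^sup>2 x\<^sub>2\<^sup>2\<close> is largest at a given height for \<open>x\<^sub>1\<^sup>2 = x\<^sub>2\<^sup>2\<close> on the sphere.\<close>

lemma deviation_le:
  fixes x :: "real ^ 3"
  assumes "x \<in> cball 0 1" "0 \<le> a" "\<And>t. t \<in> {0..1} \<Longrightarrow> error_quotient t \<le> a"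
  shows "\<bar>mono_fun k221 x + a * T3 (x $ 3)\<bar> \<le> a"
proof -
  define u where "u = (x $ 1)\<^sup>2 * (x $ 2)\<^sup>2"
  have "norm x ^ 2 \<le> 1" using assms(1) by (simp add: power_le_one)
  then have ball: "(x $ 1)\<^sup>2 + (x $ 2)\<^sup>2 + (x $ 3)\<^sup>2 \<le> 1"
    unfolding power2_norm_eq_inner by (simp add: inner_vec_def sum_3 power2_eq_square)
  then have "(x $ 3)\<^sup>2 \<le> 1"
    using zero_le_power2[of "x $ 1"] zero_le_power2[of "x $ 2"] by linarith
  then have height: "\<bar>x $ 3\<bar> \<le> 1" by (simp only: abs_square_le_1)
  have "u \<le> (((x $ 1)\<^sup>2 + (x $ 2)\<^sup>2) / 2)\<^sup>2"
  proof -
    have "(((x $ 1)\<^sup>2 + (x $ 2)\<^sup>2) / 2)\<^sup>2 - u = (((x $ 1)\<^sup>2 - (x $ 2)\<^sup>2) / 2)\<^sup>2"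
      unfolding u_def by (simp add: field_simps power2_eq_square)
    then show ?thesis by (metis diff_ge_0_iff_ge zero_le_power2)
  qed
  also have "\<dots> \<le> ((1 - (x $ 3)\<^sup>2) / 2)\<^sup>2" using ball by (intro power_mono) auto
  finally have u: "0 \<le> u" "u \<le> ((1 - (x $ 3)\<^sup>2) / 2)\<^sup>2" by (simp_all add: u_def)
  have "\<bar>u * \<bar>x $ 3\<bar> + a * T3 \<bar>x $ 3\<bar>\<bar> \<le> a"
    using u height assms by (intro deviation_le_nonneg_height) auto
  moreover have "u * \<bar>z\<bar> + a * T3 \<bar>z\<bar> = sgn z * (u * z + a * T3 z)" if "z \<noteq> 0" for z :: real
    using that by (cases "0 < z") (auto simp: T3_def algebra_simps)
  ultimately show ?thesis
    using assms(2) unfolding mono_fun_k221 u_def[symmetric]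
    by (cases "x $ 3 = 0") (auto simp: abs_mult T3_def)
qed

section \<open>The annihilating functional\<close>

text \<open>The sign \<open>\<epsilon>\<close> as a weight makes the sum blind to everything except the part of \<open>g\<close> that is even
  in the first two coordinates and odd in the third.\<close>

definition reflection_sum :: "(real ^ 3 \<Rightarrow> real) \<Rightarrow> real \<Rightarrow> real \<Rightarrow> real \<Rightarrow> real" where
  "reflection_sum g x y z =
     (\<Sum>\<rho>\<in>{1, -1}. \<Sum>\<sigma>\<in>{1, -1}. \<Sum>\<epsilon>\<in>{1, -1}. \<epsilon> * g (vector [\<rho> * x, \<sigma> * y, \<epsilon> * z]))"

lemma reflection_sum_diff:
  "reflection_sum (\<lambda>x. f x - g x) x y z = reflection_sum f x y z - reflection_sum g x y z"
  by (simp add: reflection_sum_def algebra_simps)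

lemma reflection_sum_linear_combination:
  "reflection_sum (\<lambda>x. \<Sum>k\<in>K. c k * f k x) x y z = (\<Sum>k\<in>K. c k * reflection_sum (f k) x y z)"
  by (simp add: reflection_sum_def sum.distrib sum_distrib_left sum_negf sum_subtractf algebra_simps)

lemma reflection_sum_mono_fun:
  "reflection_sum (mono_fun k) x y z =
     (if even (k $ 1) \<and> even (k $ 2) \<and> odd (k $ 3) then 8 * (x ^ k $ 1 * y ^ k $ 2 * z ^ k $ 3) else 0)"
  by (auto simp: reflection_sum_def mono_fun_3 power_minus_odd power_minus_even)

lemma abs_reflection_sum_le:
  assumes bound: "\<And>v. v \<in> cball 0 1 \<Longrightarrow> \<bar>g v\<bar> \<le> M" and ball: "x\<^sup>2 + y\<^sup>2 + z\<^sup>2 \<le> 1"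
  shows "\<bar>reflection_sum g x y z\<bar> \<le> 8 * M"
proof -
  have "vector [\<rho> * x, \<sigma> * y, \<epsilon> * z] \<in> cball (0 :: real ^ 3) 1"
    if "\<rho> \<in> {1, -1}" "\<sigma> \<in> {1, -1}" "\<epsilon> \<in> {1, -1}" for \<rho> \<sigma> \<epsilon> :: real
    using that ball by (auto simp: norm_vec_def L2_set_def sum_3)
  then have "\<bar>g (vector [\<rho> * x, \<sigma> * y, \<epsilon> * z])\<bar> \<le> M"
    if "\<rho> \<in> {1, -1}" "\<sigma> \<in> {1, -1}" "\<epsilon> \<in> {1, -1}" for \<rho> \<sigma> \<epsilon> :: real
    using that bound by blast
  note b = this
  show ?thesis
    using b[of 1 1 1] b[of 1 1 "-1"] b[of 1 "-1" 1] b[of 1 "-1" "-1"]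
      b[of "-1" 1 1] b[of "-1" 1 "-1"] b[of "-1" "-1" 1] b[of "-1" "-1" "-1"]
    by (simp add: reflection_sum_def abs_le_iff)
qed

text \<open>Of the polynomials of degree at most 4, a combination of reflection sums only has to kill
  \<open>x\<^sub>3\<close>, \<open>x\<^sub>3\<^sup>3\<close>, \<open>x\<^sub>1\<^sup>2 x\<^sub>3\<close> and \<open>x\<^sub>2\<^sup>2 x\<^sub>3\<close>.  With weight 3 at \<open>(s, s, t)\<close>, where
  \<open>s\<^sup>2 = (1 - t\<^sup>2) / 2\<close> and \<open>0 < t < 1\<close>, the first two conditions
  fix the weight at the pole and the total weight at height \<open>1/2\<close>, and the other two fix
  the distance \<open>sqrt 3 / 2\<close> of the latter points from the axis.\<close>

definition annihilator :: "real \<Rightarrow> (real ^ 3 \<Rightarrow> real) \<Rightarrow> real" where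
  "annihilator t g =
     t * (1 - 4 * t\<^sup>2) * reflection_sum g 0 0 1
     + 3 * reflection_sum g (sqrt ((1 - t\<^sup>2) / 2)) (sqrt ((1 - t\<^sup>2) / 2)) t
     - 4 * t * (1 - t\<^sup>2) * (reflection_sum g (sqrt 3 / 2) 0 (1/2) + reflection_sum g 0 (sqrt 3 / 2) (1/2))"

lemma annihilator_diff: "annihilator t (\<lambda>x. f x - g x) = annihilator t f - annihilator t g"
  by (simp add: annihilator_def reflection_sum_diff algebra_simps)

lemma annihilator_mono_fun:
  assumes "total_degree k \<le> 4" "t\<^sup>2 \<le> 1"
  shows "annihilator t (mono_fun k) = 0"
proof (cases "even (k $ 1) \<and> even (k $ 2) \<and> odd (k $ 3)")
  case True
  have "k $ 1 + k $ 2 + k $ 3 \<le> 4" using assms(1) by (simp add: total_degree_def sum_3)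
  moreover from True obtain i j l where "k $ 1 = 2 * i" "k $ 2 = 2 * j" "k $ 3 = 2 * l + 1"
    by (metis evenE oddE)
  ultimately have
    "(k $ 1, k $ 2, k $ 3) \<in> {(0, 0, 1), (0, 0, 3), (2, 0, 1), (0, 2, 1)}"
    by (cases i; cases j; cases l) auto
  moreover have "(sqrt ((1 - t\<^sup>2) / 2))\<^sup>2 = (1 - t\<^sup>2) / 2" "(sqrt 3 / 2)\<^sup>2 = 3/4"
    using assms(2) by (simp_all add: power_divide)
  ultimately show ?thesis
    by (elim insertE emptyE)
      (simp_all add: annihilator_def reflection_sum_mono_fun,
       simp_all add: power2_eq_square power3_eq_cube field_simps)
next
  case False
  have "reflection_sum (mono_fun k) x y z = 0" for x y z
    unfolding reflection_sum_mono_fun using False by (rule if_not_P)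
  then show ?thesis unfolding annihilator_def by simp
qed

lemma annihilator_poly_funs:
  assumes "p \<in> poly_funs 4" "t\<^sup>2 \<le> 1"
  shows "annihilator t p = 0"
proof -
  from assms obtain c where p: "p = (\<lambda>x. \<Sum>k | total_degree k \<le> 4. c k * mono_fun k x)"
    unfolding poly_funs_def by blast
  have "annihilator t p = (\<Sum>k | total_degree k \<le> 4. c k * annihilator t (mono_fun k))"
    unfolding p annihilator_def reflection_sum_linear_combination
    by (simp add: sum.distrib sum_subtractf sum_distrib_left algebra_simps)
  then show ?thesis using annihilator_mono_fun[OF _ assms(2)] by simp
qed

lemma annihilator_k221:
  assumes "t\<^sup>2 \<le> 1"
  shows "annihilator t (mono_fun k221) = 6 * (1 - t\<^sup>2)\<^sup>2 * t"
  using assms by (simp add: annihilator_def reflection_sum_mono_fun power2_eq_square)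

text \<open>The factor in front of \<open>M\<close> is the sum of the moduli of the weights of all point evaluations.  For
  \<open>0 \<le> t \<le> 1/2\<close> the weights of the functional have the signs of \<open>1\<close>, \<open>1\<close>, \<open>T\<^sub>3(1/2) = -1\<close>, and as it
  kills \<open>T\<^sub>3(x\<^sub>3)\<close>, the contributions of the poles and of the points at height \<open>\<plusminus>1/2\<close> to that sum add up
  to \<open>-24 T\<^sub>3(t)\<close>.\<close>

lemma abs_annihilator_le:
  assumes "0 \<le> t" "t \<le> 1/2" "\<And>v. v \<in> cball 0 1 \<Longrightarrow> \<bar>g v\<bar> \<le> M"
  shows "\<bar>annihilator t g\<bar> \<le> 24 * (1 - T3 t) * M"
proof -
  have "t\<^sup>2 \<le> (1/2)\<^sup>2" using assms by (intro power_mono) auto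
  then have t2: "t\<^sup>2 \<le> 1/4" by (simp add: power2_eq_square)
  note le = abs_reflection_sum_le[of g M, OF assms(3)]
  have weighted: "\<bar>w * r\<bar> \<le> w * b" if "0 \<le> w" "\<bar>r\<bar> \<le> b" for w r b :: real
    using that by (simp add: abs_mult mult_left_mono)
  have "\<bar>t * (1 - 4 * t\<^sup>2) * reflection_sum g 0 0 1\<bar> \<le> t * (1 - 4 * t\<^sup>2) * (8 * M)"
  proof (rule weighted)
    show "0 \<le> t * (1 - 4 * t\<^sup>2)" using assms(1) t2 by simp
    show "\<bar>reflection_sum g 0 0 1\<bar> \<le> 8 * M" by (rule le) (simp_all add: power2_eq_square)
  qed
  moreover have "\<bar>3 * reflection_sum g (sqrt ((1 - t\<^sup>2) / 2)) (sqrt ((1 - t\<^sup>2) / 2)) t\<bar> \<le> 3 * (8 * M)"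
  proof (rule weighted)
    show "\<bar>reflection_sum g (sqrt ((1 - t\<^sup>2) / 2)) (sqrt ((1 - t\<^sup>2) / 2)) t\<bar> \<le> 8 * M"
      using t2 by (intro le) simp_all
  qed simp
  moreover have "\<bar>4 * t * (1 - t\<^sup>2) *
      (reflection_sum g (sqrt 3 / 2) 0 (1/2) + reflection_sum g 0 (sqrt 3 / 2) (1/2))\<bar>
      \<le> 4 * t * (1 - t\<^sup>2) * (16 * M)"
  proof (rule weighted)
    show "0 \<le> 4 * t * (1 - t\<^sup>2)" using assms(1) t2 by simp
    have "\<bar>reflection_sum g (sqrt 3 / 2) 0 (1/2)\<bar> \<le> 8 * M" "\<bar>reflection_sum g 0 (sqrt 3 / 2) (1/2)\<bar> \<le> 8 * M"
      by (rule le; simp add: power_divide)+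
    then show "\<bar>reflection_sum g (sqrt 3 / 2) 0 (1/2) + reflection_sum g 0 (sqrt 3 / 2) (1/2)\<bar> \<le> 16 * M"
      by linarith
  qed
  ultimately have "\<bar>annihilator t g\<bar>
      \<le> t * (1 - 4 * t\<^sup>2) * (8 * M) + 3 * (8 * M) + 4 * t * (1 - t\<^sup>2) * (16 * M)"
    unfolding annihilator_def by linarith
  also have "\<dots> = 24 * (1 - T3 t) * M" unfolding T3_def by algebra
  finally show ?thesis .
qed

text \<open>Applied to the deviation, the functional does not see \<open>p\<close>; the quotient is its value on the monomial
  divided by the sum of the moduli of its weights.\<close>

lemma error_quotient_le_deviation:
  assumes "0 \<le> t" "t \<le> 1/2" "p \<in> poly_funs 4"
    and bound: "\<And>v. v \<in> cball 0 1 \<Longrightarrow> \<bar>mono_fun k221 v - p v\<bar> \<le> M"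
  shows "error_quotient t \<le> M"
proof -
  have t2: "t\<^sup>2 \<le> 1" using assms by (simp add: power_le_one)
  have T3: "1 - T3 t = (1 - t) * (1 + 4 * t + 4 * t\<^sup>2)" unfolding T3_def by algebra
  have "annihilator t (\<lambda>v. mono_fun k221 v - p v) = 6 * (1 - t\<^sup>2)\<^sup>2 * t"
    unfolding annihilator_diff[of t "mono_fun k221" p] annihilator_k221[OF t2]
      annihilator_poly_funs[OF assms(3) t2] by (rule diff_zero)
  then have "6 * (1 - t\<^sup>2)\<^sup>2 * t \<le> 24 * (1 - T3 t) * M"
    using abs_annihilator_le[of t "\<lambda>v. mono_fun k221 v - p v" M, OF assms(1,2) bound] by linarith
  moreover have "6 * (1 - t\<^sup>2)\<^sup>2 * t = 6 * (1 - t) * ((1 + t)\<^sup>2 * (1 - t) * t)" by algebra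
  moreover have "24 * (1 - T3 t) * M = 6 * (1 - t) * (M * (4 * (1 + 4 * t + 4 * t\<^sup>2)))"
    unfolding T3 by algebra
  ultimately have "6 * (1 - t) * ((1 + t)\<^sup>2 * (1 - t) * t) \<le> 6 * (1 - t) * (M * (4 * (1 + 4 * t + 4 * t\<^sup>2)))"
    by linarith
  then have "(1 + t)\<^sup>2 * (1 - t) * t \<le> M * (4 * (1 + 4 * t + 4 * t\<^sup>2))"
    by (rule mult_left_le_imp_le) (use assms(2) in simp)
  then show ?thesis
    unfolding error_quotient_def using denominator_pos[OF assms(1)] by (simp add: pos_divide_le_eq)
qed

section \<open>The Chebyshev polynomial\<close>

theorem theorem10:
  fixes a :: real
  assumes a_def: "a = (GREATEST y. \<exists>t\<in>{0..1::real}.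
      y = ((1 + t)\<^sup>2 * (1 - t) * t) / (4 * (1 + 4 * t + 4 * t\<^sup>2)))"
  shows "\<bar>a - 3.63000825 / 10 ^ 2\<bar> < 1 / 10 ^ 10
    \<and> approx_error (poly_funs 4) (mono_fun k221) (cball (0 :: real ^ 3) 1) = a
    \<and> chebyshev_poly k221 (cball 0 1) (\<lambda>x. mono_fun k221 x + a * T3 (x $ 3))"
proof -
  let ?B = "cball (0 :: real ^ 3) 1"
  let ?p = "\<lambda>x :: real ^ 3. - a * T3 (x $ 3)"
  obtain \<tau> where \<tau>: "\<tau> \<in> {0..1}" "a = error_quotient \<tau>"
    and max: "\<And>t. t \<in> {0..1} \<Longrightarrow> error_quotient t \<le> a"
  proof (rule Greatest_attained[OF _ _ continuous_on_error_quotient])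
    fix \<tau>
    assume "\<tau> \<in> {0..1}" "(GREATEST r. \<exists>x\<in>{0..1}. r = error_quotient x) = error_quotient \<tau>"
      and "\<And>t. t \<in> {0..1} \<Longrightarrow> error_quotient t \<le> error_quotient \<tau>"
    then show thesis
      using that a_def unfolding error_quotient_def by simp
  qed auto
  have large: "3630008245 / 10 ^ 11 < a"
    using error_quotient_large_value max[of "40527 / 10 ^ 5"] by simp
  then have "0 \<le> a" by simp
  have "a \<le> 3630008259 / 10 ^ 11" using error_quotient_le[of \<tau>] \<tau> by simp
  have "\<tau> \<le> 1/2"
    using error_quotient_le_right_half[of \<tau>] \<tau> large by (cases "\<tau> \<le> 1/2") auto
  have p: "?p \<in> poly_funs 4" by (rule T3_in_poly_funs)
  have lower: "a \<le> max_norm ?B (\<lambda>x. mono_fun k221 x - q x)" if "q \<in> poly_funs 4" for q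
  proof -
    have "continuous_on ?B (\<lambda>x. mono_fun k221 x - q x)"
      by (intro continuous_intros continuous_on_mono_fun continuous_on_poly_funs[OF that])
    then have "\<bar>mono_fun k221 v - q v\<bar> \<le> max_norm ?B (\<lambda>x. mono_fun k221 x - q x)" if "v \<in> ?B" for v
      using abs_le_max_norm[OF compact_cball _ that] by blast
    then show ?thesis
      unfolding \<tau>(2) using \<tau>(1) \<open>\<tau> \<le> 1/2\<close> \<open>q \<in> poly_funs 4\<close>
      by (intro error_quotient_le_deviation[of \<tau> q]) simp_all
  qed
  have norm_p: "max_norm ?B (\<lambda>x. mono_fun k221 x - ?p x) = a"
  proof -
    \<comment> \<open>The value \<open>a\<close> is taken at the north pole, where \<open>m\<close> vanishes and \<open>T\<^sub>3\<close> is 1.\<close>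
    have "vector [0, 0, 1] \<in> ?B" by (simp add: norm_vec_def L2_set_def sum_3)
    moreover have "a = \<bar>mono_fun k221 (vector [0, 0, 1]) - ?p (vector [0, 0, 1])\<bar>"
      unfolding mono_fun_k221 T3_def using \<open>0 \<le> a\<close> by simp
    ultimately have "\<exists>x\<in>?B. a = \<bar>mono_fun k221 x - ?p x\<bar>" by blast
    then show ?thesis
      unfolding max_norm_def using deviation_le[OF _ \<open>0 \<le> a\<close> max]
      by (intro Greatest_equality) auto
  qed
  have best: "best_approximant (poly_funs 4) (mono_fun k221) ?B ?p"
    unfolding best_approximant_def norm_p using p lower by blast
  have "\<bar>a - 3.63000825 / 10 ^ 2\<bar> < 1 / 10 ^ 10"
    using large \<open>a \<le> 3630008259 / 10 ^ 11\<close> unfolding abs_less_iff by simp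
  moreover have "approx_error (poly_funs 4) (mono_fun k221) ?B = a"
    unfolding best_approximant_error[OF best, symmetric] by (rule norm_p)
  moreover have "chebyshev_poly k221 ?B (\<lambda>x. mono_fun k221 x + a * T3 (x $ 3))"
    unfolding chebyshev_poly_def total_degree_k221
    by (intro exI[of _ ?p] conjI) (use best in simp_all)
  ultimately show ?thesis by blast
qed

end
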